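(* $$\sum_{n=1}^{\infty}\frac{1}{2^{n+1}}\sum_{k=1}^{n}\binom{n}{k}\frac{H_k^{(2)}}{k^4}=\zeta(2)\zeta(4)+\zeta^2(3)-\frac{25}{12}\zeta(6).$$
   Context: $H_k^{(r)}=\sum_{j=1}^k \frac{1}{j^r}$ denotes the generalized harmonic number, $\zeta$ is the Riemann zeta function, and $\zeta^2(3)=(\zeta(3))^2$. *)

theory Defs
  imports "HOL-Analysis.Analysis"
begin

definition gen_harm :: "nat \<Rightarrow> nat \<Rightarrow> real" where
  "gen_harm r k = (\<Sum>j=1..k. 1 / real j ^ r)"

text \<open>
  The Riemann zeta function at integer arguments \<open>s \<ge> 2\<close>, where it is given by its Dirichlet
  series; for \<open>s \<le> 1\<close> the series diverges and the value of \<open>zeta s\<close> carries no meaning.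
\<close>

definition zeta :: "nat \<Rightarrow> real" where
  "zeta s = (\<Sum>n. 1 / real (Suc n) ^ s)"

end

theory Submission
  imports Defs
begin

text \<open>
  Since \<open>(\<Sum>n. (n choose k) / 2 ^ (n + 1)) = 1\<close> for every \<open>k\<close>, exchanging the two summations
  turns the series into the Euler sum of \<open>H\<^sub>k\<^sup>(\<^sup>2\<^sup>) / k ^ 4\<close>, which is \<open>\<zeta>(4,2) + \<zeta>(6)\<close>. The double
  zeta values of weight 6 are then eliminated from a linear system: splitting the products
  \<open>\<zeta>(3) \<zeta>(3)\<close> and \<open>\<zeta>(2) \<zeta>(4)\<close> by the order of the indices (stuffle) and by partial fractions
  (shuffle), together with the sum formula \<open>\<zeta>(5,1) + \<zeta>(4,2) + \<zeta>(3,3) + \<zeta>(2,4) = \<zeta>(6)\<close>.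
\<close>

section \<open>Interchange of summation and the binomial transform\<close>

text \<open>Tonelli: for nonnegative terms, convergent iterated sums already force summability over
  the whole index set.\<close>

lemma has_sum_Sigma_nonneg:
  fixes f :: "'a \<times> 'b \<Rightarrow> real"
  assumes "\<And>x. x \<in> A \<Longrightarrow> ((\<lambda>y. f (x, y)) has_sum g x) (B x)"
    and "(g has_sum S) A"
    and "\<And>x y. x \<in> A \<Longrightarrow> y \<in> B x \<Longrightarrow> 0 \<le> f (x, y)"
  shows "(f has_sum S) (Sigma A B)"
proof (rule has_sum_SigmaI)
  show "f summable_on Sigma A B"
    by (rule summable_on_SigmaI[where g = g]) (use assms in \<open>auto dest: has_sum_imp_summable\<close>)
qed (use assms in auto)

lemma sums_binomial_half: "(\<lambda>n. real (n choose k) / 2 ^ (n + 1)) sums 1"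
proof (induction k)
  case 0
  show ?case
    using sums_mult[OF geometric_sums[of "1/2::real"], of "1/2"]
    by (simp add: power_divide)
next
  case (Suc k)
  define g where "g = (\<lambda>j n. real (n choose j) / 2 ^ (n + 1))"
  have g0: "g j n \<ge> 0" for j n
    by (simp add: g_def)
  \<comment> \<open>Pascal's rule telescopes: the partial sums for \<open>k\<close> and
    \<open>Suc k\<close> differ only by a boundary term.\<close>
  have S: "(\<Sum>n<N. g (Suc k) n) = (\<Sum>n<N. g k n) - 2 * g (Suc k) N" for N
  proof (induction N)
    case 0
    show ?case by (simp add: g_def)
  next
    case (Suc N)
    have "2 * g (Suc k) (Suc N) = g (Suc k) N + g k N"
      by (simp add: g_def field_simps)
    with Suc show ?case by simp
  qed
  have IH: "g k sums 1"
    using Suc by (simp add: g_def)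
  \<comment> \<open>The boundary term is nonnegative, so \<open>S\<close> bounds the partial sums;
    the resulting summability then sends that term to 0.\<close>
  have "(\<Sum>n<N. g (Suc k) n) \<le> 1" for N
  proof -
    have "(\<Sum>n<N. g (Suc k) n) \<le> (\<Sum>n<N. g k n)"
      using S[of N] g0[of "Suc k" N] by linarith
    also have "\<dots> \<le> suminf (g k)"
      using IH g0 by (intro sum_le_suminf sums_summable) auto
    also have "\<dots> = 1"
      using IH by (rule sums_unique[symmetric])
    finally show ?thesis .
  qed
  then have "summable (g (Suc k))"
    by (intro summableI_nonneg_bounded[where x = 1] g0)
  then have "(\<lambda>N. g (Suc k) N) \<longlonglongrightarrow> 0"
    by (rule summable_LIMSEQ_zero)
  from tendsto_diff[OF IH[unfolded sums_def] tendsto_mult_left[OF this, of 2]]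
  have "(\<lambda>N. (\<Sum>n<N. g k n) - 2 * g (Suc k) N) \<longlonglongrightarrow> 1"
    by simp
  then have "g (Suc k) sums 1"
    by (simp add: sums_def S)
  then show ?case
    by (simp add: g_def)
qed

text \<open>Tonelli for \<open>c k * (n choose k) / 2 ^ (n + 1)\<close>: with \<open>k\<close> fixed
  the sum over \<open>n\<close> is \<open>c k\<close>; with \<open>n\<close> fixed the terms vanish
  for \<open>k > n\<close>.\<close>

lemma has_sum_binomial_transform_half:
  fixes c :: "nat \<Rightarrow> real"
  assumes c: "(c has_sum S) UNIV" and nonneg: "\<And>k. 0 \<le> c k"
  shows "(\<lambda>n. 1 / 2 ^ (n + 1) * (\<Sum>k\<le>n. real (n choose k) * c k)) sums S"
proof -
  define f where "f = (\<lambda>(k, n). c k * (real (n choose k) / 2 ^ (n + 1)))"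
  have "((\<lambda>n. f (k, n)) has_sum c k * 1) UNIV" for k
    unfolding f_def prod.case
    by (intro has_sum_cmult_right sums_nonneg_imp_has_sum sums_binomial_half) auto
  then have "(f has_sum S) (UNIV \<times> UNIV)"
    using c nonneg by (intro has_sum_Sigma_nonneg[where g = c]) (auto simp: f_def)
  then have *: "((\<lambda>(n, k). f (k, n)) has_sum S) (UNIV \<times> UNIV)"
    by (subst (asm) has_sum_swap)
  have "((\<lambda>n. 1 / 2 ^ (n + 1) * (\<Sum>k\<le>n. real (n choose k) * c k)) has_sum S) UNIV"
  proof (rule has_sum_SigmaD[OF *])
    fix n :: nat
    show "((\<lambda>k. case (n, k) of (n, k) \<Rightarrow> f (k, n)) has_sum
        1 / 2 ^ (n + 1) * (\<Sum>k\<le>n. real (n choose k) * c k)) UNIV"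
      by (rule has_sum_finite_neutralI[of "{..n}"])
        (auto simp: f_def sum_divide_distrib binomial_eq_0 mult_ac)
  qed
  then show ?thesis
    by (rule has_sum_imp_sums)
qed

section \<open>Zeta products and double zeta values as sums over pairs\<close>

abbreviation pos :: "nat set" where "pos \<equiv> {0<..}"

lemma has_sum_pos_iff: "(f has_sum S) pos \<longleftrightarrow> ((\<lambda>n. f (Suc n)) has_sum S) UNIV"
proof -
  have "bij_betw Suc UNIV pos"
    by (rule bij_betwI[of _ _ _ "\<lambda>n. n - 1"]) auto
  from has_sum_reindex_bij_betw[OF this] show ?thesis
    by metis
qed

lemma has_sum_zeta:
  assumes "s \<ge> 2"
  shows "((\<lambda>n. 1 / real n ^ s) has_sum zeta s) pos"
proof -
  have "summable (\<lambda>n. inverse (real n ^ s))"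
    by (rule inverse_power_summable[OF assms])
  then have "summable (\<lambda>n. 1 / real (Suc n) ^ s)"
    by (subst summable_Suc_iff) (simp add: inverse_eq_divide)
  then show ?thesis
    unfolding has_sum_pos_iff zeta_def by (intro sums_nonneg_imp_has_sum summable_sums) auto
qed

lemma has_sum_zeta_mult:
  assumes "r \<ge> 2" "s \<ge> 2"
  shows "((\<lambda>(p, q). 1 / (real p ^ r * real q ^ s)) has_sum zeta r * zeta s) (pos \<times> pos)"
proof (rule has_sum_Sigma_nonneg)
  show "((\<lambda>p. 1 / real p ^ r * zeta s) has_sum zeta r * zeta s) pos"
    by (intro has_sum_cmult_left has_sum_zeta assms)
  show "((\<lambda>q. case (p, q) of (p, q) \<Rightarrow> 1 / (real p ^ r * real q ^ s)) has_sum
      1 / real p ^ r * zeta s) pos" for p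
    using has_sum_cmult_right[OF has_sum_zeta[OF assms(2)], of "1 / real p ^ r"] by simp
qed auto

text \<open>
  The double zeta value \<open>\<zeta>(a,b)\<close>, the sum of \<open>1 / (m ^ a * n ^ b)\<close> over \<open>m > n > 0\<close>,
  parametrised by \<open>p = m - n\<close> and \<open>q = n\<close>.
\<close>

definition dzeta :: "nat \<Rightarrow> nat \<Rightarrow> real" where
  "dzeta a b = infsum (\<lambda>(p, q). 1 / (real (p + q) ^ a * real q ^ b)) (pos \<times> pos)"

text \<open>Comparison with the product series of \<open>zeta 2 * zeta (a + b - 2)\<close>: two
  factors \<open>p + q\<close> are bounded below by \<open>p\<close>, the other \<open>a - 2\<close>
  by \<open>q\<close>. This covers \<open>b = 1\<close> as well.\<close>

lemma has_sum_dzeta: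
  assumes "a \<ge> 2" "a + b \<ge> 4"
  shows "((\<lambda>(p, q). 1 / (real (p + q) ^ a * real q ^ b)) has_sum dzeta a b) (pos \<times> pos)"
  unfolding dzeta_def
proof (rule has_sum_infsum, rule summable_on_comparison_test)
  show "(\<lambda>(p, q). 1 / (real p ^ 2 * real q ^ (a + b - 2))) summable_on pos \<times> pos"
    using assms by (intro has_sum_imp_summable[OF has_sum_zeta_mult]) auto
  fix x :: "nat \<times> nat" assume "x \<in> pos \<times> pos"
  then obtain p q where x: "x = (p, q)" "p > 0" "q > 0" by auto
  have "real p ^ 2 * real q ^ (a + b - 2) = (real p ^ 2 * real q ^ (a - 2)) * real q ^ b"
    using assms by (simp add: power_add[symmetric])
  also have "\<dots> \<le> (real (p + q) ^ 2 * real (p + q) ^ (a - 2)) * real q ^ b"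
    by (intro mult_mono power_mono) auto
  also have "real (p + q) ^ 2 * real (p + q) ^ (a - 2) = real (p + q) ^ a"
    by (metis assms(1) le_add_diff_inverse power_add)
  finally show "(case x of (p, q) \<Rightarrow> 1 / (real (p + q) ^ a * real q ^ b))
      \<le> (case x of (p, q) \<Rightarrow> 1 / (real p ^ 2 * real q ^ (a + b - 2)))"
    using x by (auto intro!: divide_left_mono)
qed auto

lemma has_sum_dzeta_swap:
  assumes "a \<ge> 2" "a + b \<ge> 4"
  shows "((\<lambda>(p, q). 1 / (real (p + q) ^ a * real p ^ b)) has_sum dzeta a b) (pos \<times> pos)"
  using has_sum_dzeta[OF assms] by (subst has_sum_swap) (simp add: add.commute)

lemma has_sum_dzeta_less:
  assumes "a \<ge> 2" "a + b \<ge> 4"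
  shows "((\<lambda>(m, n). 1 / (real m ^ a * real n ^ b)) has_sum dzeta a b) {(m, n). 0 < n \<and> n < m}"
proof -
  have "bij_betw (\<lambda>(p, q). (p + q, q)) (pos \<times> pos) {(m, n). 0 < n \<and> n < m}"
    by (rule bij_betwI[of _ _ _ "\<lambda>(m, n). (m - n, n)"]) auto
  from has_sum_reindex_bij_betw[OF this, of "\<lambda>(m, n). 1 / (real m ^ a * real n ^ b)"]
  show ?thesis
    using has_sum_dzeta[OF assms] by (simp add: case_prod_unfold)
qed

lemma has_sum_zeta_diag:
  assumes "a + b \<ge> 2"
  shows "((\<lambda>(m, n). 1 / (real m ^ a * real n ^ b)) has_sum zeta (a + b)) {(m, n). 0 < n \<and> n = m}"
proof -
  have "bij_betw (\<lambda>n. (n, n)) pos {(m, n). 0 < n \<and> n = m}"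
    by (rule bij_betwI[of _ _ _ fst]) auto
  from has_sum_reindex_bij_betw[OF this, of "\<lambda>(m, n). 1 / (real m ^ a * real n ^ b)"]
  show ?thesis
    using has_sum_zeta[OF assms] by (simp add: power_add)
qed

lemma has_sum_le_pairs:
  assumes "a \<ge> 2" "a + b \<ge> 4"
  shows "((\<lambda>(m, n). 1 / (real m ^ a * real n ^ b)) has_sum dzeta a b + zeta (a + b))
    {(m, n). 0 < n \<and> n \<le> m}"
proof -
  have "((\<lambda>(m, n). 1 / (real m ^ a * real n ^ b)) has_sum dzeta a b + zeta (a + b))
      ({(m, n). 0 < n \<and> n < m} \<union> {(m, n). 0 < n \<and> n = m})"
    using assms by (intro has_sum_Un_disjoint has_sum_dzeta_less has_sum_zeta_diag) auto
  also have "{(m, n). 0 < n \<and> n < m} \<union> {(m, n). 0 < n \<and> n = m} = {(m, n). 0 < n \<and> n \<le> (m::nat)}"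
    by auto
  finally show ?thesis .
qed

lemma zeta_mult_stuffle:
  assumes "r \<ge> 2" "s \<ge> 2"
  shows "zeta r * zeta s = dzeta r s + dzeta s r + zeta (r + s)"
proof -
  let ?f = "\<lambda>(m, n). 1 / (real m ^ r * real n ^ s)"
  have "bij_betw (\<lambda>(m, n). (n, m)) {(m, n). 0 < n \<and> n < m} {(n, m). 0 < n \<and> n < (m::nat)}"
    by (rule bij_betwI[of _ _ _ "\<lambda>(m, n). (n, m)"]) auto
  from has_sum_reindex_bij_betw[OF this, of ?f]
  have "(?f has_sum dzeta s r) {(n, m). 0 < n \<and> n < m}"
    using has_sum_dzeta_less[of s r] assms by (simp add: case_prod_unfold mult.commute)
  then have "(?f has_sum dzeta r s + zeta (r + s) + dzeta s r)
      ({(m, n). 0 < n \<and> n \<le> m} \<union> {(n, m). 0 < n \<and> n < m})"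
    using assms by (intro has_sum_Un_disjoint has_sum_le_pairs) auto
  also have "{(m, n). 0 < n \<and> n \<le> m} \<union> {(n, m). 0 < n \<and> n < m} = pos \<times> pos"
    by auto
  finally show ?thesis
    using has_sum_unique[OF has_sum_zeta_mult[OF assms]] by simp
qed

text \<open>Grouping the pairs \<open>n \<le> m\<close> by \<open>m\<close> produces the harmonic
  numbers; the diagonal contributes \<open>zeta (a + b)\<close>.\<close>

lemma has_sum_gen_harm:
  assumes "a \<ge> 2" "a + b \<ge> 4"
  shows "((\<lambda>n. gen_harm b n / real n ^ a) has_sum dzeta a b + zeta (a + b)) pos"
proof (rule has_sum_SigmaD)
  have "{(m, n). 0 < n \<and> n \<le> m} = Sigma pos (\<lambda>m. {1..m})"
    by auto
  with has_sum_le_pairs[OF assms]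
  show "((\<lambda>(m, n). 1 / (real m ^ a * real n ^ b)) has_sum dzeta a b + zeta (a + b))
      (Sigma pos (\<lambda>m. {1..m}))"
    by simp
  show "((\<lambda>n. case (m, n) of (m, n) \<Rightarrow> 1 / (real m ^ a * real n ^ b)) has_sum
      gen_harm b m / real m ^ a) {1..m}" for m
    by (rule has_sum_finiteI) (auto simp: gen_harm_def sum_divide_distrib mult.commute)
qed

section \<open>Partial fractions and shuffle products\<close>

text \<open>In the reciprocals \<open>u\<close>, \<open>v\<close>, \<open>w\<close> of
  \<open>x\<close>, \<open>y\<close>, \<open>m\<close> this reads
  \<open>u * v = w * (u + v)\<close>; the expansions below are polynomial consequences of
  it.\<close>

lemma inverse_mult_eq_inverse_add:
  fixes x y m :: real
  assumes "m = x + y" "x > 0" "y > 0"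
  shows "(1 / x) * (1 / y) = (1 / m) * (1 / x + 1 / y)"
  using assms by (simp add: field_simps)

text \<open>In the expansion of \<open>1 / (x ^ a * y ^ b)\<close>, the terms with
  \<open>m ^ i\<close> have coefficient \<open>(i - 1) choose (a - 1)\<close> beside a power of
  \<open>y\<close> and \<open>(i - 1) choose (b - 1)\<close> beside a power of
  \<open>x\<close>.\<close>

lemma partial_fractions_3_3:
  fixes x y m :: real
  assumes "m = x + y" "x > 0" "y > 0"
  shows "1 / (x ^ 3 * y ^ 3) = 1 / (m ^ 3 * y ^ 3) + 1 / (m ^ 3 * x ^ 3)
    + 3 * (1 / (m ^ 4 * y ^ 2) + 1 / (m ^ 4 * x ^ 2))
    + 6 * (1 / (m ^ 5 * y ^ 1) + 1 / (m ^ 5 * x ^ 1))"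
proof -
  have "u ^ 3 * v ^ 3 = w ^ 3 * v ^ 3 + w ^ 3 * u ^ 3 + 3 * (w ^ 4 * v ^ 2 + w ^ 4 * u ^ 2)
      + 6 * (w ^ 5 * v ^ 1 + w ^ 5 * u ^ 1)" if "u * v = w * (u + v)" for u v w :: real
    using that by algebra
  from this[OF inverse_mult_eq_inverse_add[OF assms]] show ?thesis
    by (simp add: power_one_over)
qed

lemma partial_fractions_2_4:
  fixes x y m :: real
  assumes "m = x + y" "x > 0" "y > 0"
  shows "1 / (x ^ 2 * y ^ 4) = 1 / (m ^ 2 * y ^ 4) + 2 * (1 / (m ^ 3 * y ^ 3))
    + 3 * (1 / (m ^ 4 * y ^ 2)) + 1 / (m ^ 4 * x ^ 2)
    + 4 * (1 / (m ^ 5 * y ^ 1) + 1 / (m ^ 5 * x ^ 1))"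
proof -
  have "u ^ 2 * v ^ 4 = w ^ 2 * v ^ 4 + 2 * (w ^ 3 * v ^ 3) + 3 * (w ^ 4 * v ^ 2) + w ^ 4 * u ^ 2
      + 4 * (w ^ 5 * v ^ 1 + w ^ 5 * u ^ 1)" if "u * v = w * (u + v)" for u v w :: real
    using that by algebra
  from this[OF inverse_mult_eq_inverse_add[OF assms]] show ?thesis
    by (simp add: power_one_over)
qed

text \<open>Each replacement of \<open>u * v\<close> by \<open>w * (u + v)\<close> splits off one
  term free of \<open>u\<close>; the last one also leaves \<open>w ^ 5 * u\<close>.\<close>

lemma partial_fractions_sum_formula:
  fixes x y m :: real
  assumes "m = x + y" "x > 0" "y > 0"
  shows "1 / (x * m * y ^ 4) = 1 / (m ^ 5 * y ^ 1) + 1 / (m ^ 4 * y ^ 2) + 1 / (m ^ 3 * y ^ 3)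
    + 1 / (m ^ 2 * y ^ 4) + 1 / (m ^ 5 * x ^ 1)"
proof -
  have "u * w * v ^ 4 = w ^ 5 * v ^ 1 + w ^ 4 * v ^ 2 + w ^ 3 * v ^ 3 + w ^ 2 * v ^ 4
      + w ^ 5 * u ^ 1" if "u * v = w * (u + v)" for u v w :: real
    using that by algebra
  from this[OF inverse_mult_eq_inverse_add[OF assms]] show ?thesis
    by (simp add: power_one_over)
qed

lemma has_sum_pos_pairs_cong:
  assumes "((\<lambda>(p, q). f p q) has_sum S) (pos \<times> pos)"
    and "\<And>p q. p > 0 \<Longrightarrow> q > 0 \<Longrightarrow> g p q = f p q"
  shows "((\<lambda>(p, q). g p q) has_sum S) (pos \<times> pos)"
proof -
  have "((\<lambda>(p, q). g p q) has_sum S) (pos \<times> pos) \<longleftrightarrow> ((\<lambda>(p, q). f p q) has_sum S) (pos \<times> pos)"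
    by (intro has_sum_cong) (auto simp: assms(2))
  with assms(1) show ?thesis
    by blast
qed

text \<open>By symmetry the terms in \<open>p\<close> and in \<open>q\<close> have equal sums, which
  doubles the coefficients 1, 3, 6.\<close>

lemma zeta_3_mult_3_shuffle:
  "zeta 3 * zeta 3 = 2 * dzeta 3 3 + 6 * dzeta 4 2 + 12 * dzeta 5 1"
proof -
  let ?d = "\<lambda>a b p q. 1 / (real (p + q) ^ a * real q ^ b)"
  let ?e = "\<lambda>a b p q. 1 / (real (p + q) ^ a * real p ^ b)"
  have pf: "1 / (real p ^ 3 * real q ^ 3) =
      ?d 3 3 p q + ?e 3 3 p q + 3 * (?d 4 2 p q + ?e 4 2 p q) + 6 * (?d 5 1 p q + ?e 5 1 p q)"
    if "p > 0" "q > 0" for p q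
    using that by (intro partial_fractions_3_3) auto
  have "((\<lambda>(p, q). ?d 3 3 p q + ?e 3 3 p q + 3 * (?d 4 2 p q + ?e 4 2 p q)
      + 6 * (?d 5 1 p q + ?e 5 1 p q)) has_sum
      dzeta 3 3 + dzeta 3 3 + 3 * (dzeta 4 2 + dzeta 4 2) + 6 * (dzeta 5 1 + dzeta 5 1))
      (pos \<times> pos)"
    unfolding case_prod_unfold
    by (intro has_sum_add has_sum_cmult_right has_sum_dzeta[unfolded case_prod_unfold]
        has_sum_dzeta_swap[unfolded case_prod_unfold]) auto
  from has_sum_pos_pairs_cong[OF this pf]
  show ?thesis
    using has_sum_unique[OF has_sum_zeta_mult[of 3 3]] by simp
qed

lemma zeta_2_mult_4_shuffle:
  "zeta 2 * zeta 4 = dzeta 2 4 + 2 * dzeta 3 3 + 4 * dzeta 4 2 + 8 * dzeta 5 1"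
proof -
  let ?d = "\<lambda>a b p q. 1 / (real (p + q) ^ a * real q ^ b)"
  let ?e = "\<lambda>a b p q. 1 / (real (p + q) ^ a * real p ^ b)"
  have pf: "1 / (real p ^ 2 * real q ^ 4) =
      ?d 2 4 p q + 2 * ?d 3 3 p q + 3 * ?d 4 2 p q + ?e 4 2 p q + 4 * (?d 5 1 p q + ?e 5 1 p q)"
    if "p > 0" "q > 0" for p q
    using that by (intro partial_fractions_2_4) auto
  have "((\<lambda>(p, q). ?d 2 4 p q + 2 * ?d 3 3 p q + 3 * ?d 4 2 p q + ?e 4 2 p q
      + 4 * (?d 5 1 p q + ?e 5 1 p q)) has_sum
      dzeta 2 4 + 2 * dzeta 3 3 + 3 * dzeta 4 2 + dzeta 4 2 + 4 * (dzeta 5 1 + dzeta 5 1))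
      (pos \<times> pos)"
    unfolding case_prod_unfold
    by (intro has_sum_add has_sum_cmult_right has_sum_dzeta[unfolded case_prod_unfold]
        has_sum_dzeta_swap[unfolded case_prod_unfold]) auto
  from has_sum_pos_pairs_cong[OF this pf]
  show ?thesis
    using has_sum_unique[OF has_sum_zeta_mult[of 2 4]] by simp
qed

section \<open>The sum formula in weight 6\<close>

text \<open>Raising \<open>q\<close> by one adds a telescoping series with sum
  \<open>1 / Suc q\<close>.\<close>

lemma sums_harm_telescope:
  "(\<lambda>p. 1 / real (Suc p) - 1 / real (Suc p + q)) sums gen_harm 1 q"
proof (induction q)
  case 0
  show ?case by (simp add: gen_harm_def)
next
  case (Suc q)
  have "(\<lambda>p. 1 / real (Suc p + q)) \<longlonglongrightarrow> 0"
    using LIMSEQ_ignore_initial_segment[OF lim_1_over_n, of "Suc q"] by (simp add: add_ac)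
  from telescope_sums'[OF this]
  have "(\<lambda>p. 1 / real (Suc p + q) - 1 / real (Suc p + Suc q)) sums (1 / real (Suc q))"
    by (simp add: add_ac)
  from sums_add[OF Suc this] show ?case
    by (simp add: gen_harm_def)
qed

lemma has_sum_harm_partial_fractions:
  assumes "q > 0"
  shows "((\<lambda>p. 1 / (real p * real (p + q))) has_sum gen_harm 1 q / real q) pos"
proof -
  have "(1 / real (Suc p) - 1 / real (Suc p + q)) / real q = 1 / (real (Suc p) * real (Suc p + q))"
    for p
    using assms by (simp add: divide_simps)
  with sums_divide[OF sums_harm_telescope[of q], of "real q"]
  have "(\<lambda>p. 1 / (real (Suc p) * real (Suc p + q))) sums (gen_harm 1 q / real q)"
    by (simp only:)
  then show ?thesis
    unfolding has_sum_pos_iff by (rule sums_nonneg_imp_has_sum) simp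
qed

text \<open>
  The finite geometric sum over the exponents equals \<open>(1 / n ^ 4 - 1 / m ^ 4) / (m * (m - n))\<close>.
  Both of its parts converge on their own, the first one to the Euler sum of \<open>H\<^sub>n / n ^ 5\<close>.
\<close>

lemma dzeta_sum_formula_6: "dzeta 5 1 + dzeta 4 2 + dzeta 3 3 + dzeta 2 4 = zeta 6"
proof -
  let ?d = "\<lambda>a b p q. 1 / (real (p + q) ^ a * real q ^ b)"
  let ?e = "\<lambda>a b p q. 1 / (real (p + q) ^ a * real p ^ b)"
  let ?w = "\<lambda>p q. 1 / (real p * real (p + q) * real q ^ 4)"
  have "((\<lambda>(q, p). ?w p q) has_sum dzeta 5 1 + zeta (5 + 1)) (pos \<times> pos)"
  proof (rule has_sum_Sigma_nonneg)
    show "((\<lambda>q. gen_harm 1 q / real q ^ 5) has_sum dzeta 5 1 + zeta (5 + 1)) pos"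
      by (rule has_sum_gen_harm) auto
    fix q :: nat assume "q \<in> pos"
    then show "((\<lambda>p. case (q, p) of (q, p) \<Rightarrow> ?w p q) has_sum gen_harm 1 q / real q ^ 5) pos"
      using has_sum_cmult_left[OF has_sum_harm_partial_fractions, of q "1 / real q ^ 4"]
      by (simp add: eval_nat_numeral mult_ac)
  qed auto
  then have w: "((\<lambda>(p, q). ?w p q) has_sum dzeta 5 1 + zeta 6) (pos \<times> pos)"
    by (subst has_sum_swap) simp
  have pf: "?w p q = ?d 5 1 p q + ?d 4 2 p q + ?d 3 3 p q + ?d 2 4 p q + ?e 5 1 p q"
    if "p > 0" "q > 0" for p q
    using that by (intro partial_fractions_sum_formula) auto
  have "((\<lambda>(p, q). ?d 5 1 p q + ?d 4 2 p q + ?d 3 3 p q + ?d 2 4 p q + ?e 5 1 p q)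
      has_sum dzeta 5 1 + dzeta 4 2 + dzeta 3 3 + dzeta 2 4 + dzeta 5 1) (pos \<times> pos)"
    unfolding case_prod_unfold
    by (intro has_sum_add has_sum_dzeta[unfolded case_prod_unfold]
        has_sum_dzeta_swap[unfolded case_prod_unfold]) auto
  \<comment> \<open>The term in \<open>p\<close> yields a second \<open>dzeta 5 1\<close>, which
    cancels the one coming from the Euler sum in \<open>w\<close>.\<close>
  from has_sum_unique[OF w has_sum_pos_pairs_cong[OF this pf]]
  show ?thesis
    by simp
qed

section \<open>Elimination and conclusion\<close>

text \<open>Shuffle minus stuffle gives \<open>6 * dzeta 4 2 + 12 * dzeta 5 1 = zeta 6\<close> and
  \<open>2 * dzeta 3 3 + 3 * dzeta 4 2 + 8 * dzeta 5 1 = zeta 6\<close>, hence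
  \<open>dzeta 4 2 = (zeta 3)^2 - 4/3 * zeta 6\<close>. The sum formula then forces
  \<open>zeta 2 * zeta 4 = 7/4 * zeta 6\<close>, and 25/12 = 7/4 + 1/3.\<close>

lemma euler_sum_2_4: "dzeta 4 2 + zeta 6 = zeta 2 * zeta 4 + (zeta 3)\<^sup>2 - 25 / 12 * zeta 6"
  using zeta_mult_stuffle[of 3 3] zeta_mult_stuffle[of 2 4] zeta_3_mult_3_shuffle
    zeta_2_mult_4_shuffle dzeta_sum_formula_6
  by (simp add: power2_eq_square)

theorem theorem4p13:
  shows "(\<lambda>m. let n = Suc m in
            1 / 2 ^ (n + 1) * (\<Sum>k=1..n. real (n choose k) * (gen_harm 2 k / real k ^ 4)))
         sums (zeta 2 * zeta 4 + (zeta 3)\<^sup>2 - 25 / 12 * zeta 6)"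
proof -
  define c where "c = (\<lambda>k. gen_harm 2 k / real k ^ 4)"
  have c0: "c 0 = 0" and nonneg: "c k \<ge> 0" for k
    by (simp_all add: c_def gen_harm_def sum_nonneg)
  have "(c has_sum dzeta 4 2 + zeta 6) pos"
    using has_sum_gen_harm[of 4 2] by (simp add: c_def)
  \<comment> \<open>The value \<open>c 0\<close> is 0, so the index 0 may be added.\<close>
  also have "?this \<longleftrightarrow> (c has_sum dzeta 4 2 + zeta 6) UNIV"
    by (rule has_sum_cong_neutral) (auto simp: c0)
  finally have "(\<lambda>n. 1 / 2 ^ (n + 1) * (\<Sum>k\<le>n. real (n choose k) * c k)) sums
      (dzeta 4 2 + zeta 6)"
    by (rule has_sum_binomial_transform_half) (rule nonneg)
  moreover have "(\<Sum>k\<le>n. real (n choose k) * c k) = (\<Sum>k=1..n. real (n choose k) * c k)" for n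
    by (rule sum.mono_neutral_right) (auto simp: c0 not_le Suc_le_eq)
  ultimately have "(\<lambda>n. 1 / 2 ^ (n + 1) * (\<Sum>k=1..n. real (n choose k) * c k)) sums
      (dzeta 4 2 + zeta 6)"
    by simp
  \<comment> \<open>The term at \<open>n = 0\<close> is an empty sum, so starting at
    \<open>n = 1\<close> keeps the value.\<close>
  then show ?thesis
    unfolding Let_def c_def by (subst sums_Suc_iff) (simp add: euler_sum_2_4)
qed

end
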